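(* Let $n_1,n_2>4$ be integers, let $\mathcal{C}=(\mathbb{Z}/n_1\mathbb{Z})\times(\mathbb{Z}/n_2\mathbb{Z})$, let $Q\subseteq\mathbb{R}$ be a set with at least two elements and $0\in Q$, and let $f$ be a local rule for two-dimensional cellular automata with the von Neumann neighborhood (of range one) and state set $Q$. Then $f$ is number-conserving if and only if for all $q_1,q_2,q_3,q_4,q_5\in Q$ it holds that $$\begin{aligned} f[q_1,q_2,q_3,q_4,q_5]={}& q_1+f[0,q_2,0,0,q_5]-f[0,q_1,0,0,q_4]+f[0,0,0,q_4,q_5]-f[0,0,0,q_1,q_2]\\ &+f[0,0,q_3,q_4,0]-f[0,0,q_2,q_3,0]+f[0,0,q_3,0,q_5]-f[0,0,q_1,0,q_3]\\ &+f[0,0,q_2,0,0]-f[0,0,q_3,0,0]+f[0,0,0,q_3,0]-f[0,0,0,q_4,0]\\ &+f[0,0,0,0,q_2]+f[0,0,0,0,q_3]+f[0,0,0,0,q_4]-f[0,0,0,0,q_1]-2f[0,0,0,0,q_5]. \end{aligned}$$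
   Context: Setting (dimension $2$). The cell space is $\mathcal{C}=(\mathbb{Z}/n_1\mathbb{Z})\times(\mathbb{Z}/n_2\mathbb{Z})$ with fixed integers $n_1,n_2>4$ (periodic boundary conditions). Let $\vec v_1=(1,0)$, $\vec v_2=(0,1)$, $\vec 0=(0,0)$ and $V=\{\vec 0,\vec v_1,-\vec v_1,\vec v_2,-\vec v_2\}$; for $\mathbf{i}\in\mathcal{C}$ and $\vec v\in V$, the cell $\mathbf{i}+\vec v$ is computed componentwise modulo $n_1,n_2$. The state set $Q\subseteq\mathbb{R}$ (finite or infinite) has at least two elements and contains $0$. A neighborhood configuration is a function $N:V\to Q$; a local rule is a function $f$ from the set of all neighborhood configurations to $Q$. We write $f[q_1,q_2,q_3,q_4,q_5]$ for $f(N)$, where $N(\vec v_2)=q_1$ (up), $N(-\vec v_1)=q_2$ (left), $N(\vec 0)=q_3$ (center), $N(\vec v_1)=q_4$ (right), $N(-\vec v_2)=q_5$ (down). A configuration is a map $\mathbf{x}:\mathcal{C}\to Q$, and $\sigma(\mathbf{x})=\sum_{\mathbf{i}\in\mathcal{C}}\mathbf{x}(\mathbf{i})$. The global rule $F$ induced by $f$ is $F(\mathbf{x})(\mathbf{i})=f(N_{\mathbf{x},\mathbf{i}})$, where $N_{\mathbf{x},\mathbf{i}}(\vec v)=\mathbf{x}(\mathbf{i}+\vec v)$ for $\vec v\in V$. The local rule $f$ is number-conserving if $\sigma(F(\mathbf{x}))=\sigma(\mathbf{x})$ for every configuration $\mathbf{x}$. *)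

theory Defs
  imports Complex_Main "HOL-Library.FuncSet"
begin

(* The torus Z/n1 x Z/n2, with each residue class given by its least non-negative representative. *)
definition cells :: "int \<Rightarrow> int \<Rightarrow> (int \<times> int) set" where
  "cells n1 n2 = {0..<n1} \<times> {0..<n2}"

definition translate :: "int \<Rightarrow> int \<Rightarrow> int \<times> int \<Rightarrow> int \<times> int \<Rightarrow> int \<times> int" where
  "translate n1 n2 i v = ((fst i + fst v) mod n1, (snd i + snd v) mod n2)"

definition von_neumann :: "(int \<times> int) set" where
  "von_neumann = {(0, 0), (1, 0), (-1, 0), (0, 1), (0, -1)}"

(* Maps with a restricted domain are functions that are undefined outside that domain. This makes
   von_neumann \<rightarrow>\<^sub>E Q exactly the set of maps from the neighborhood to Q, so a local rule
   sees nothing but the five neighborhood states. *)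
definition neighborhood_configs :: "real set \<Rightarrow> (int \<times> int \<Rightarrow> real) set" where
  "neighborhood_configs Q = von_neumann \<rightarrow>\<^sub>E Q"

definition local_rules :: "real set \<Rightarrow> ((int \<times> int \<Rightarrow> real) \<Rightarrow> real) set" where
  "local_rules Q = neighborhood_configs Q \<rightarrow> Q"

definition configs :: "int \<Rightarrow> int \<Rightarrow> real set \<Rightarrow> (int \<times> int \<Rightarrow> real) set" where
  "configs n1 n2 Q = cells n1 n2 \<rightarrow>\<^sub>E Q"

definition neighborhood_of ::
    "int \<Rightarrow> int \<Rightarrow> (int \<times> int \<Rightarrow> real) \<Rightarrow> int \<times> int \<Rightarrow> (int \<times> int \<Rightarrow> real)" where
  "neighborhood_of n1 n2 x i = (\<lambda>v\<in>von_neumann. x (translate n1 n2 i v))"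

definition global_rule ::
    "int \<Rightarrow> int \<Rightarrow> ((int \<times> int \<Rightarrow> real) \<Rightarrow> real) \<Rightarrow> (int \<times> int \<Rightarrow> real) \<Rightarrow> (int \<times> int \<Rightarrow> real)" where
  "global_rule n1 n2 f x = (\<lambda>i\<in>cells n1 n2. f (neighborhood_of n1 n2 x i))"

definition total :: "int \<Rightarrow> int \<Rightarrow> (int \<times> int \<Rightarrow> real) \<Rightarrow> real" where
  "total n1 n2 x = (\<Sum>i\<in>cells n1 n2. x i)"

definition number_conserving ::
    "int \<Rightarrow> int \<Rightarrow> real set \<Rightarrow> ((int \<times> int \<Rightarrow> real) \<Rightarrow> real) \<Rightarrow> bool" where
  "number_conserving n1 n2 Q f \<longleftrightarrow>
     (\<forall>x\<in>configs n1 n2 Q. total n1 n2 (global_rule n1 n2 f x) = total n1 n2 x)"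

(* The order of the states is up, left, center, right, down. *)
definition rule_value ::
    "((int \<times> int \<Rightarrow> real) \<Rightarrow> real) \<Rightarrow> real \<Rightarrow> real \<Rightarrow> real \<Rightarrow> real \<Rightarrow> real \<Rightarrow> real"
    ("_\<lbrakk>_, _, _, _, _\<rbrakk>" [1000, 0, 0, 0, 0, 0] 1000) where
  "f\<lbrakk>q1, q2, q3, q4, q5\<rbrakk> = f (\<lambda>v\<in>von_neumann.
     if v = (0, 1) then q1
     else if v = (-1, 0) then q2
     else if v = (0, 0) then q3
     else if v = (1, 0) then q4
     else q5)"

end

theory Submission
  imports Defs
begin

(* Summed over the torus, the right-hand side of the identity telescopes to the sum of the states q1,
   as all other terms cancel in pairs of translates. Conversely, number conservation
   of a configuration that vanishes outside a single cross of five cells is a linear relation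
   between values of f: exactly thirteen cells see the cross, and since n1, n2 > 4 they are distinct.
   The identity is a linear combination of instances of this relation with most of the five
   states equal to 0. *)

lemma translate_in_cells:
  assumes "n1 > 0" and "n2 > 0"
  shows "translate n1 n2 i v \<in> cells n1 n2"
  using assms by (simp add: translate_def cells_def)

lemma translate_translate:
  "translate n1 n2 (translate n1 n2 i v) w = translate n1 n2 i (fst v + fst w, snd v + snd w)"
  by (simp add: translate_def mod_add_left_eq add.assoc)

lemma translate_zero:
  assumes "i \<in> cells n1 n2"
  shows "translate n1 n2 i (0, 0) = i"
  using assms by (auto simp: translate_def cells_def)

lemma sum_cells_translate:
  assumes "n1 > 0" and "n2 > 0"
  shows "(\<Sum>i\<in>cells n1 n2. g (translate n1 n2 i v)) = (\<Sum>i\<in>cells n1 n2. g i)"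
proof (rule sum.reindex_bij_witness)
  fix i assume "i \<in> cells n1 n2"
  then show "translate n1 n2 (translate n1 n2 i v) (- fst v, - snd v) = i"
    "translate n1 n2 (translate n1 n2 i (- fst v, - snd v)) v = i"
    by (simp_all add: translate_translate translate_zero)
qed (simp_all add: translate_in_cells[OF assms])

text \<open>Both pairs of offsets have the same difference vector, so one common shift
  \<open>u\<close> carries \<open>(v, w)\<close> to \<open>(v', w')\<close>, and a shift only
  permutes the cells. This is what cancels the terms depending on two states.\<close>

lemma sum_cells_translate_pair:
  fixes h :: "real \<Rightarrow> real \<Rightarrow> real"
  assumes "n1 > 0" and "n2 > 0"
    and "fst v' - fst v = fst w' - fst w" and "snd v' - snd v = snd w' - snd w"
  shows "(\<Sum>i\<in>cells n1 n2. h (x (translate n1 n2 i v)) (x (translate n1 n2 i w))) =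
    (\<Sum>i\<in>cells n1 n2. h (x (translate n1 n2 i v')) (x (translate n1 n2 i w')))"
proof -
  define u where "u = (fst v' - fst v, snd v' - snd v)"
  have "v' = (fst u + fst v, snd u + snd v)" "w' = (fst u + fst w, snd u + snd w)"
    using assms by (auto simp: u_def prod_eq_iff)
  then show ?thesis
    using sum_cells_translate[OF assms(1,2), where
        g = "\<lambda>i. h (x (translate n1 n2 i v)) (x (translate n1 n2 i w))" and v = u]
    by (simp add: translate_translate)
qed

lemma rule_value_neighborhood:
  "f (neighborhood_of n1 n2 x i) =
    f\<lbrakk>x (translate n1 n2 i (0, 1)), x (translate n1 n2 i (-1, 0)), x (translate n1 n2 i (0, 0)),
      x (translate n1 n2 i (1, 0)), x (translate n1 n2 i (0, -1))\<rbrakk>"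
proof -
  have "neighborhood_of n1 n2 x i = (\<lambda>v\<in>von_neumann.
     if v = (0, 1) then x (translate n1 n2 i (0, 1))
     else if v = (-1, 0) then x (translate n1 n2 i (-1, 0))
     else if v = (0, 0) then x (translate n1 n2 i (0, 0))
     else if v = (1, 0) then x (translate n1 n2 i (1, 0))
     else x (translate n1 n2 i (0, -1)))"
    unfolding neighborhood_of_def by (rule restrict_ext) (auto simp: von_neumann_def)
  then show ?thesis by (simp add: rule_value_def)
qed

lemma total_global_rule:
  "total n1 n2 (global_rule n1 n2 f x) = (\<Sum>i\<in>cells n1 n2.
    f\<lbrakk>x (translate n1 n2 i (0, 1)), x (translate n1 n2 i (-1, 0)), x (translate n1 n2 i (0, 0)),
      x (translate n1 n2 i (1, 0)), x (translate n1 n2 i (0, -1))\<rbrakk>)"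
  by (simp add: total_def global_rule_def rule_value_neighborhood)

text \<open>The centre (2, 2) places the five cells at coordinates 1 to 3 and all their neighbors at
  coordinates 0 to 4, which are least representatives when both periods exceed 4. The function lives
  on the whole integer plane, so it can be evaluated without modular reduction.\<close>

definition cross :: "real \<Rightarrow> real \<Rightarrow> real \<Rightarrow> real \<Rightarrow> real \<Rightarrow> int \<times> int \<Rightarrow> real" where
  "cross q1 q2 q3 q4 q5 c =
    (if c = (2, 3) then q1 else if c = (1, 2) then q2 else if c = (2, 2) then q3
     else if c = (3, 2) then q4 else if c = (2, 1) then q5 else 0)"

text \<open>Wrapping occurs only from -1 to n - 1 and from n to 0. Since n - 1 > 3, neither result,
  and neither unreduced value, lies in {1, 2, 3}.\<close>

lemma step_mod_eq_iff:
  fixes a d k n :: int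
  assumes "n > 4" and "a \<in> {0..<n}" and "d \<in> {-1, 0, 1}" and "k \<in> {1, 2, 3}"
  shows "(a + d) mod n = k \<longleftrightarrow> a + d = k"
proof -
  consider "a + d = -1" | "a + d = n" | "0 \<le> a + d \<and> a + d < n"
    using assms by fastforce
  then show ?thesis
  proof cases
    case 1
    then have "(a + d) mod n = n - 1"
      using assms(1) by (simp add: zmod_minus1)
    then show ?thesis using 1 assms by auto
  next
    case 2
    then show ?thesis using assms by auto
  next
    case 3
    then show ?thesis by (simp add: mod_pos_pos_trivial)
  qed
qed

text \<open>\<open>cross\<close> compares coordinates only with 1, 2 and 3, and wrapping around
  never affects such a comparison. Arithmetic on the torus thus becomes arithmetic in the
  plane.\<close>

lemma cross_translate:
  assumes "n1 > 4" and "n2 > 4" and "(a, b) \<in> cells n1 n2" and "d \<in> {-1, 0, 1}" and "e \<in> {-1, 0, 1}"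
  shows "cross q1 q2 q3 q4 q5 (translate n1 n2 (a, b) (d, e)) = cross q1 q2 q3 q4 q5 (a + d, b + e)"
proof -
  have a: "(a + d) mod n1 = k \<longleftrightarrow> a + d = k" and b: "(b + e) mod n2 = k \<longleftrightarrow> b + e = k"
    if "k \<in> {1, 2, 3}" for k
    using that assms by (simp_all only: step_mod_eq_iff cells_def mem_Sigma_iff)
  show ?thesis
    by (simp only: cross_def translate_def fst_conv snd_conv prod.inject a b insert_iff simp_thms)
qed

lemma total_cross:
  assumes "n1 > 4" and "n2 > 4"
  shows "total n1 n2 (cross q1 q2 q3 q4 q5) = q1 + q2 + q3 + q4 + q5"
proof -
  have "total n1 n2 (cross q1 q2 q3 q4 q5) =
    (\<Sum>c\<in>{(2, 3), (1, 2), (2, 2), (3, 2), (2, 1)}. cross q1 q2 q3 q4 q5 c)"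
    unfolding total_def
    by (rule sum.mono_neutral_right) (use assms in \<open>auto simp: cells_def cross_def\<close>)
  then show ?thesis by (simp add: cross_def)
qed

lemma number_conserving_cross:
  assumes n: "n1 > 4" "n2 > 4" and "0 \<in> Q" and nc: "number_conserving n1 n2 Q f"
    and zero: "f\<lbrakk>0, 0, 0, 0, 0\<rbrakk> = 0"
    and q: "q1 \<in> Q" "q2 \<in> Q" "q3 \<in> Q" "q4 \<in> Q" "q5 \<in> Q"
  shows "f\<lbrakk>q1, q2, q3, q4, q5\<rbrakk> + f\<lbrakk>0, 0, q1, 0, q3\<rbrakk> + f\<lbrakk>0, 0, q2, q3, 0\<rbrakk> + f\<lbrakk>0, q3, q4, 0, 0\<rbrakk>
    + f\<lbrakk>q3, 0, q5, 0, 0\<rbrakk> + f\<lbrakk>0, 0, 0, 0, q1\<rbrakk> + f\<lbrakk>0, 0, 0, q2, 0\<rbrakk> + f\<lbrakk>0, q4, 0, 0, 0\<rbrakk>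
    + f\<lbrakk>q5, 0, 0, 0, 0\<rbrakk> + f\<lbrakk>0, q1, 0, 0, q4\<rbrakk> + f\<lbrakk>0, 0, 0, q1, q2\<rbrakk> + f\<lbrakk>q4, q5, 0, 0, 0\<rbrakk>
    + f\<lbrakk>q2, 0, 0, q5, 0\<rbrakk> = q1 + q2 + q3 + q4 + q5"
proof -
  let ?y = "cross q1 q2 q3 q4 q5"
  define x where "x = restrict ?y (cells n1 n2)"
  \<comment> \<open>The cells at taxicab distance at most 2 from the centre, listed in the order of
    the thirteen terms of the conclusion.\<close>
  define S :: "(int \<times> int) set" where "S = {(2, 2), (2, 3), (1, 2), (3, 2), (2, 1), (2, 4), (0, 2),
    (4, 2), (2, 0), (3, 3), (1, 3), (3, 1), (1, 1)}"
  define g where "g = (\<lambda>(a, b). f\<lbrakk>?y (a, b + 1), ?y (a - 1, b), ?y (a, b), ?y (a + 1, b), ?y (a, b - 1)\<rbrakk>)"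
  have "x \<in> configs n1 n2 Q"
    using q assms(3) by (auto simp: x_def configs_def cross_def)
  then have "total n1 n2 (global_rule n1 n2 f x) = total n1 n2 x"
    using nc by (simp add: number_conserving_def)
  also have "total n1 n2 x = q1 + q2 + q3 + q4 + q5"
    using total_cross[OF n] by (simp add: total_def x_def)
  finally have "q1 + q2 + q3 + q4 + q5 = total n1 n2 (global_rule n1 n2 f x)" ..
  also have "\<dots> = (\<Sum>c\<in>cells n1 n2. g c)"
    unfolding total_global_rule
  proof (rule sum.cong)
    fix c assume "c \<in> cells n1 n2"
    moreover have "x (translate n1 n2 c v) = ?y (translate n1 n2 c v)" for v
      using n by (simp add: x_def translate_in_cells)
    ultimately show "f\<lbrakk>x (translate n1 n2 c (0, 1)), x (translate n1 n2 c (-1, 0)),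
        x (translate n1 n2 c (0, 0)), x (translate n1 n2 c (1, 0)), x (translate n1 n2 c (0, -1))\<rbrakk> = g c"
      by (cases c) (simp add: g_def cross_translate[OF n])
  qed simp
  also have "\<dots> = (\<Sum>c\<in>S. g c)"
  proof (rule sum.mono_neutral_right)
    show "finite (cells n1 n2)" by (simp add: cells_def)
    show "S \<subseteq> cells n1 n2" using n by (auto simp: S_def cells_def)
    show "\<forall>c\<in>cells n1 n2 - S. g c = 0"
    proof
      fix c assume "c \<in> cells n1 n2 - S"
      moreover obtain a b where c: "c = (a, b)" by fastforce
      ultimately have "(a, b) \<notin> S" by simp
      \<comment> \<open>\<open>S\<close> contains every cell with a cross cell in its neighborhood,
        so a cell outside it sees only zeros.\<close>
      then have "?y (a, b + 1) = 0" "?y (a - 1, b) = 0" "?y (a, b) = 0" "?y (a + 1, b) = 0"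
        "?y (a, b - 1) = 0"
        by (auto simp: S_def cross_def)
      then show "g c = 0" by (simp add: g_def c zero)
    qed
  qed
  finally show ?thesis by (simp add: S_def g_def cross_def)
qed

text \<open>On the zero configuration every cell contributes the same value, and the number of cells
  is positive. This makes the cells away from a cross contribute nothing.\<close>

lemma number_conserving_zero:
  assumes "n1 > 0" "n2 > 0" "0 \<in> Q" "number_conserving n1 n2 Q f"
  shows "f\<lbrakk>0, 0, 0, 0, 0\<rbrakk> = 0"
proof -
  let ?x = "restrict (\<lambda>_. 0 :: real) (cells n1 n2)"
  have "?x \<in> configs n1 n2 Q" using assms(3) by (simp add: configs_def)
  then have "total n1 n2 (global_rule n1 n2 f ?x) = 0"
    using assms(4) by (simp add: number_conserving_def total_def)
  then have "real (card (cells n1 n2)) * f\<lbrakk>0, 0, 0, 0, 0\<rbrakk> = 0"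
    by (simp add: total_global_rule translate_in_cells[OF assms(1,2)])
  then show ?thesis
    using assms(1,2) by (simp add: cells_def)
qed

theorem theorem3p4:
  fixes n1 n2 :: int
    and Q :: "real set"
    and f :: "(int \<times> int \<Rightarrow> real) \<Rightarrow> real"
  assumes "n1 > 4" and "n2 > 4"
    and "\<exists>a\<in>Q. \<exists>b\<in>Q. a \<noteq> b"
    and "0 \<in> Q"
    and "f \<in> local_rules Q"
  shows "number_conserving n1 n2 Q f \<longleftrightarrow>
    (\<forall>q1\<in>Q. \<forall>q2\<in>Q. \<forall>q3\<in>Q. \<forall>q4\<in>Q. \<forall>q5\<in>Q.
      f\<lbrakk>q1, q2, q3, q4, q5\<rbrakk> =
        q1 + f\<lbrakk>0, q2, 0, 0, q5\<rbrakk> - f\<lbrakk>0, q1, 0, 0, q4\<rbrakk> + f\<lbrakk>0, 0, 0, q4, q5\<rbrakk> - f\<lbrakk>0, 0, 0, q1, q2\<rbrakk>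
        + f\<lbrakk>0, 0, q3, q4, 0\<rbrakk> - f\<lbrakk>0, 0, q2, q3, 0\<rbrakk> + f\<lbrakk>0, 0, q3, 0, q5\<rbrakk> - f\<lbrakk>0, 0, q1, 0, q3\<rbrakk>
        + f\<lbrakk>0, 0, q2, 0, 0\<rbrakk> - f\<lbrakk>0, 0, q3, 0, 0\<rbrakk> + f\<lbrakk>0, 0, 0, q3, 0\<rbrakk> - f\<lbrakk>0, 0, 0, q4, 0\<rbrakk>
        + f\<lbrakk>0, 0, 0, 0, q2\<rbrakk> + f\<lbrakk>0, 0, 0, 0, q3\<rbrakk> + f\<lbrakk>0, 0, 0, 0, q4\<rbrakk> - f\<lbrakk>0, 0, 0, 0, q1\<rbrakk>
        - 2 * f\<lbrakk>0, 0, 0, 0, q5\<rbrakk>)"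
    (is "_ \<longleftrightarrow> ?formula")
proof
  assume nc: "number_conserving n1 n2 Q f"
  have zero: "f\<lbrakk>0, 0, 0, 0, 0\<rbrakk> = 0"
    using number_conserving_zero[of n1 n2 Q f] assms nc by simp
  note E = number_conserving_cross[OF assms(1,2,4) nc zero]
  show ?formula
  proof (intro ballI)
    fix q1 q2 q3 q4 q5 assume q: "q1 \<in> Q" "q2 \<in> Q" "q3 \<in> Q" "q4 \<in> Q" "q5 \<in> Q"
    \<comment> \<open>A single state q at the centre is seen by five cells, once in each position.
      The relation serves to eliminate the values with q on top, which the formula avoids.\<close>
    have single: "f\<lbrakk>q, 0, 0, 0, 0\<rbrakk> = q - f\<lbrakk>0, q, 0, 0, 0\<rbrakk> - f\<lbrakk>0, 0, q, 0, 0\<rbrakk> - f\<lbrakk>0, 0, 0, q, 0\<rbrakk>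
        - f\<lbrakk>0, 0, 0, 0, q\<rbrakk>" if "q \<in> Q" for q
      using E[of 0 0 q 0 0] that assms(4) zero by simp
    show "f\<lbrakk>q1, q2, q3, q4, q5\<rbrakk> =
        q1 + f\<lbrakk>0, q2, 0, 0, q5\<rbrakk> - f\<lbrakk>0, q1, 0, 0, q4\<rbrakk> + f\<lbrakk>0, 0, 0, q4, q5\<rbrakk> - f\<lbrakk>0, 0, 0, q1, q2\<rbrakk>
        + f\<lbrakk>0, 0, q3, q4, 0\<rbrakk> - f\<lbrakk>0, 0, q2, q3, 0\<rbrakk> + f\<lbrakk>0, 0, q3, 0, q5\<rbrakk> - f\<lbrakk>0, 0, q1, 0, q3\<rbrakk>
        + f\<lbrakk>0, 0, q2, 0, 0\<rbrakk> - f\<lbrakk>0, 0, q3, 0, 0\<rbrakk> + f\<lbrakk>0, 0, 0, q3, 0\<rbrakk> - f\<lbrakk>0, 0, 0, q4, 0\<rbrakk>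
        + f\<lbrakk>0, 0, 0, 0, q2\<rbrakk> + f\<lbrakk>0, 0, 0, 0, q3\<rbrakk> + f\<lbrakk>0, 0, 0, 0, q4\<rbrakk> - f\<lbrakk>0, 0, 0, 0, q1\<rbrakk>
        - 2 * f\<lbrakk>0, 0, 0, 0, q5\<rbrakk>"
      \<comment> \<open>Subtract from the full relation the four two-state instances, whose leading
        terms are the pair values absent from the formula: up-center, left-center, up-left and
        up-right. The leftover values with one state on top or on the left are removed by
        \<open>single\<close>; for \<open>q5\<close> it is used twice, whence the coefficient
        2.\<close>
      using E[OF q] E[OF q(3) assms(4) q(5) assms(4) assms(4)]
        E[OF assms(4) q(3) q(4) assms(4) assms(4)] E[OF q(4) q(5) assms(4) assms(4) assms(4)]
        E[OF q(2) assms(4) assms(4) q(5) assms(4)]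
        single[OF q(2)] single[OF q(3)] single[OF q(4)] single[OF q(5)] zero
      by linarith
  qed
next
  assume formula: ?formula
  show "number_conserving n1 n2 Q f"
    unfolding number_conserving_def
  proof
    fix x assume x: "x \<in> configs n1 n2 Q"
    have pos: "n1 > 0" "n2 > 0" using assms by auto
    let ?C = "cells n1 n2"
    let ?x = "\<lambda>v i. x (translate n1 n2 i v)"
    let ?u = "?x (0, 1)" and ?l = "?x (-1, 0)" and ?c = "?x (0, 0)" and ?r = "?x (1, 0)"
      and ?d = "?x (0, -1)"
    have in_Q: "?x v i \<in> Q" for v i
      using x PiE_mem[OF _ translate_in_cells[OF pos]] unfolding configs_def by blast
    note pair = sum_cells_translate_pair[OF pos, where x = x]
    \<comment> \<open>The offset from left to down equals that from up to right, namely (1, -1);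
      from right to down and from up to left it is (-1, -1).\<close>
    have diag: "(\<Sum>i\<in>?C. f\<lbrakk>0, ?l i, 0, 0, ?d i\<rbrakk>) = (\<Sum>i\<in>?C. f\<lbrakk>0, ?u i, 0, 0, ?r i\<rbrakk>)"
      "(\<Sum>i\<in>?C. f\<lbrakk>0, 0, 0, ?r i, ?d i\<rbrakk>) = (\<Sum>i\<in>?C. f\<lbrakk>0, 0, 0, ?u i, ?l i\<rbrakk>)"
      by (rule pair[where h = "\<lambda>p q. f\<lbrakk>0, p, 0, 0, q\<rbrakk>"], simp, simp)
        (rule pair[where h = "\<lambda>p q. f\<lbrakk>0, 0, 0, p, q\<rbrakk>"], simp, simp)
    have straight: "(\<Sum>i\<in>?C. f\<lbrakk>0, 0, ?c i, ?r i, 0\<rbrakk>) = (\<Sum>i\<in>?C. f\<lbrakk>0, 0, ?l i, ?c i, 0\<rbrakk>)"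
      "(\<Sum>i\<in>?C. f\<lbrakk>0, 0, ?c i, 0, ?d i\<rbrakk>) = (\<Sum>i\<in>?C. f\<lbrakk>0, 0, ?u i, 0, ?c i\<rbrakk>)"
      by (rule pair[where h = "\<lambda>p q. f\<lbrakk>0, 0, p, q, 0\<rbrakk>"], simp, simp)
        (rule pair[where h = "\<lambda>p q. f\<lbrakk>0, 0, p, 0, q\<rbrakk>"], simp, simp)
    have single: "(\<Sum>i\<in>?C. h (?x v i)) = (\<Sum>i\<in>?C. h (x i))" for h :: "real \<Rightarrow> real" and v
      by (rule sum_cells_translate[OF pos, where g = "\<lambda>i. h (x i)"])
    have "total n1 n2 (global_rule n1 n2 f x) = (\<Sum>i\<in>?C. f\<lbrakk>?u i, ?l i, ?c i, ?r i, ?d i\<rbrakk>)"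
      by (rule total_global_rule)
    also have "\<dots> = (\<Sum>i\<in>?C.
        ?u i + f\<lbrakk>0, ?l i, 0, 0, ?d i\<rbrakk> - f\<lbrakk>0, ?u i, 0, 0, ?r i\<rbrakk>
        + f\<lbrakk>0, 0, 0, ?r i, ?d i\<rbrakk> - f\<lbrakk>0, 0, 0, ?u i, ?l i\<rbrakk>
        + f\<lbrakk>0, 0, ?c i, ?r i, 0\<rbrakk> - f\<lbrakk>0, 0, ?l i, ?c i, 0\<rbrakk>
        + f\<lbrakk>0, 0, ?c i, 0, ?d i\<rbrakk> - f\<lbrakk>0, 0, ?u i, 0, ?c i\<rbrakk>
        + f\<lbrakk>0, 0, ?l i, 0, 0\<rbrakk> - f\<lbrakk>0, 0, ?c i, 0, 0\<rbrakk> + f\<lbrakk>0, 0, 0, ?c i, 0\<rbrakk> - f\<lbrakk>0, 0, 0, ?r i, 0\<rbrakk>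
        + f\<lbrakk>0, 0, 0, 0, ?l i\<rbrakk> + f\<lbrakk>0, 0, 0, 0, ?c i\<rbrakk> + f\<lbrakk>0, 0, 0, 0, ?r i\<rbrakk> - f\<lbrakk>0, 0, 0, 0, ?u i\<rbrakk>
        - 2 * f\<lbrakk>0, 0, 0, 0, ?d i\<rbrakk>)"
      by (rule sum.cong[OF refl], rule formula[rule_format]) (rule in_Q)+
    also have "\<dots> = (\<Sum>i\<in>?C. x i)"
      \<comment> \<open>Once every one-state sum is moved to the same cell, the coefficients of each
        kind add up to 0; for the bottom position they are 1 + 1 + 1 - 1 - 2. Only the sum of the
        upper states survives.\<close>
      by (simp only: sum.distrib sum_subtractf sum_distrib_left[symmetric] diag straight
          single[of "\<lambda>q. q"] single[of "\<lambda>q. f\<lbrakk>0, 0, q, 0, 0\<rbrakk>"]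
          single[of "\<lambda>q. f\<lbrakk>0, 0, 0, q, 0\<rbrakk>"] single[of "\<lambda>q. f\<lbrakk>0, 0, 0, 0, q\<rbrakk>"])
    finally show "total n1 n2 (global_rule n1 n2 f x) = total n1 n2 x"
      by (simp add: total_def)
  qed
qed

end
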